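(* Let $p$ be an odd prime and let $k$ be a positive integer. Then there exist exactly $2k^2+2$ pairwise non-isomorphic (as rings) generalized quaternion rings over $\mathbb{Z}/p^k\mathbb{Z}$; that is, the rings $\left(\frac{a,b}{\mathbb{Z}/p^k\mathbb{Z}}\right)$ with $a,b\in\mathbb{Z}/p^k\mathbb{Z}$ arbitrary form exactly $2k^2+2$ isomorphism classes.
   Context: For a commutative ring $R$ with identity and $a,b\in R$ (not necessarily units, possibly zero), the generalized quaternion ring $\left(\frac{a,b}{R}\right)$ is the free $R$-module with basis $\{1,i,j,k\}$ equipped with the associative unital $R$-bilinear multiplication determined by $i^2=a$, $j^2=b$, $ij=-ji=k$. *)

theory Defs
  imports "HOL-Algebra.QuotRing" "HOL-Number_Theory.Residues"
begin

(* The 4-tuple (x0, x1, x2, x3) stands for x0 + x1 i + x2 j + x3 k. The product is the bilinear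
   extension of the multiplication table forced by associativity and i^2 = a, j^2 = b, ij = -ji = k:
     k^2 = -ab,  jk = -kj = -b i,  ki = -ik = -a j. *)
definition gen_quaternion_ring ::
  "('a, 'm) ring_scheme \<Rightarrow> 'a \<Rightarrow> 'a \<Rightarrow> ('a \<times> 'a \<times> 'a \<times> 'a) ring" where
  "gen_quaternion_ring R a b =
    \<lparr>carrier = carrier R \<times> carrier R \<times> carrier R \<times> carrier R,
     monoid.mult = (\<lambda>(x0, x1, x2, x3) (y0, y1, y2, y3).
       ((x0 \<otimes>\<^bsub>R\<^esub> y0) \<oplus>\<^bsub>R\<^esub> (a \<otimes>\<^bsub>R\<^esub> (x1 \<otimes>\<^bsub>R\<^esub> y1)) \<oplus>\<^bsub>R\<^esub> (b \<otimes>\<^bsub>R\<^esub> (x2 \<otimes>\<^bsub>R\<^esub> y2))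
          \<ominus>\<^bsub>R\<^esub> ((a \<otimes>\<^bsub>R\<^esub> b) \<otimes>\<^bsub>R\<^esub> (x3 \<otimes>\<^bsub>R\<^esub> y3)),
        (x0 \<otimes>\<^bsub>R\<^esub> y1) \<oplus>\<^bsub>R\<^esub> (x1 \<otimes>\<^bsub>R\<^esub> y0) \<ominus>\<^bsub>R\<^esub> (b \<otimes>\<^bsub>R\<^esub> (x2 \<otimes>\<^bsub>R\<^esub> y3))
          \<oplus>\<^bsub>R\<^esub> (b \<otimes>\<^bsub>R\<^esub> (x3 \<otimes>\<^bsub>R\<^esub> y2)),
        (x0 \<otimes>\<^bsub>R\<^esub> y2) \<oplus>\<^bsub>R\<^esub> (x2 \<otimes>\<^bsub>R\<^esub> y0) \<oplus>\<^bsub>R\<^esub> (a \<otimes>\<^bsub>R\<^esub> (x1 \<otimes>\<^bsub>R\<^esub> y3))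
          \<ominus>\<^bsub>R\<^esub> (a \<otimes>\<^bsub>R\<^esub> (x3 \<otimes>\<^bsub>R\<^esub> y1)),
        (x0 \<otimes>\<^bsub>R\<^esub> y3) \<oplus>\<^bsub>R\<^esub> (x3 \<otimes>\<^bsub>R\<^esub> y0) \<oplus>\<^bsub>R\<^esub> (x1 \<otimes>\<^bsub>R\<^esub> y2)
          \<ominus>\<^bsub>R\<^esub> (x2 \<otimes>\<^bsub>R\<^esub> y1))),
     one = (\<one>\<^bsub>R\<^esub>, \<zero>\<^bsub>R\<^esub>, \<zero>\<^bsub>R\<^esub>, \<zero>\<^bsub>R\<^esub>),
     zero = (\<zero>\<^bsub>R\<^esub>, \<zero>\<^bsub>R\<^esub>, \<zero>\<^bsub>R\<^esub>, \<zero>\<^bsub>R\<^esub>),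
     add = (\<lambda>(x0, x1, x2, x3) (y0, y1, y2, y3).
       (x0 \<oplus>\<^bsub>R\<^esub> y0, x1 \<oplus>\<^bsub>R\<^esub> y1, x2 \<oplus>\<^bsub>R\<^esub> y2, x3 \<oplus>\<^bsub>R\<^esub> y3))\<rparr>"

definition gen_quaternion_rings ::
  "('a, 'm) ring_scheme \<Rightarrow> ('a \<times> 'a \<times> 'a \<times> 'a) ring set" where
  "gen_quaternion_rings R =
    {gen_quaternion_ring R a b | a b. a \<in> carrier R \<and> b \<in> carrier R}"

definition ring_iso_rel_on :: "('a, 'm) ring_scheme set \<Rightarrow> (('a, 'm) ring_scheme) rel" where
  "ring_iso_rel_on S = {(A, B). A \<in> S \<and> B \<in> S \<and> A \<simeq> B}"

context cring
begin

lemma gen_quaternion_ring_is_ring: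
  assumes [simp]: "a \<in> carrier R" "b \<in> carrier R"
  shows "ring (gen_quaternion_ring R a b)"
proof (rule ringI)
  show "abelian_group (gen_quaternion_ring R a b)"
  proof (rule abelian_groupI)
    fix x assume "x \<in> carrier (gen_quaternion_ring R a b)"
    then obtain x0 x1 x2 x3 where x: "x = (x0, x1, x2, x3)"
      "x0 \<in> carrier R" "x1 \<in> carrier R" "x2 \<in> carrier R" "x3 \<in> carrier R"
      by (auto simp: gen_quaternion_ring_def)
    show "\<exists>y\<in>carrier (gen_quaternion_ring R a b).
        y \<oplus>\<^bsub>gen_quaternion_ring R a b\<^esub> x = \<zero>\<^bsub>gen_quaternion_ring R a b\<^esub>"
      using x by (intro bexI[of _ "(\<ominus> x0, \<ominus> x1, \<ominus> x2, \<ominus> x3)"])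
        (auto simp: gen_quaternion_ring_def l_neg)
  qed (auto simp: gen_quaternion_ring_def a_ac)
next
  show "Group.monoid (gen_quaternion_ring R a b)"
  proof (rule monoidI)
    fix x y z
    assume "x \<in> carrier (gen_quaternion_ring R a b)" "y \<in> carrier (gen_quaternion_ring R a b)"
      "z \<in> carrier (gen_quaternion_ring R a b)"
    then obtain x0 x1 x2 x3 y0 y1 y2 y3 z0 z1 z2 z3 where *:
      "x = (x0, x1, x2, x3)" "y = (y0, y1, y2, y3)" "z = (z0, z1, z2, z3)"
      "x0 \<in> carrier R" "x1 \<in> carrier R" "x2 \<in> carrier R" "x3 \<in> carrier R"
      "y0 \<in> carrier R" "y1 \<in> carrier R" "y2 \<in> carrier R" "y3 \<in> carrier R"
      "z0 \<in> carrier R" "z1 \<in> carrier R" "z2 \<in> carrier R" "z3 \<in> carrier R"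
      by (auto simp: gen_quaternion_ring_def)
    show "x \<otimes>\<^bsub>gen_quaternion_ring R a b\<^esub> y \<otimes>\<^bsub>gen_quaternion_ring R a b\<^esub> z =
        x \<otimes>\<^bsub>gen_quaternion_ring R a b\<^esub> (y \<otimes>\<^bsub>gen_quaternion_ring R a b\<^esub> z)"
      using *(4-) unfolding *(1-3)
      by (simp add: gen_quaternion_ring_def minus_eq l_distr r_distr minus_add l_minus r_minus
          m_ac a_ac)
  qed (auto simp: gen_quaternion_ring_def minus_eq)
next
  fix x y z
  assume "x \<in> carrier (gen_quaternion_ring R a b)" "y \<in> carrier (gen_quaternion_ring R a b)"
    "z \<in> carrier (gen_quaternion_ring R a b)"
  then show
    "(x \<oplus>\<^bsub>gen_quaternion_ring R a b\<^esub> y) \<otimes>\<^bsub>gen_quaternion_ring R a b\<^esub> z =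
      x \<otimes>\<^bsub>gen_quaternion_ring R a b\<^esub> z \<oplus>\<^bsub>gen_quaternion_ring R a b\<^esub>
      y \<otimes>\<^bsub>gen_quaternion_ring R a b\<^esub> z"
    "z \<otimes>\<^bsub>gen_quaternion_ring R a b\<^esub> (x \<oplus>\<^bsub>gen_quaternion_ring R a b\<^esub> y) =
      z \<otimes>\<^bsub>gen_quaternion_ring R a b\<^esub> x \<oplus>\<^bsub>gen_quaternion_ring R a b\<^esub>
      z \<otimes>\<^bsub>gen_quaternion_ring R a b\<^esub> y"
    by (auto simp: gen_quaternion_ring_def minus_eq l_distr r_distr minus_add a_ac)
qed

lemma gen_quaternion_ring_relations:
  assumes "a \<in> carrier R" "b \<in> carrier R"
  defines "Q \<equiv> gen_quaternion_ring R a b"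
    and "i \<equiv> (\<zero>, \<one>, \<zero>, \<zero>)" and "j \<equiv> (\<zero>, \<zero>, \<one>, \<zero>)" and "k \<equiv> (\<zero>, \<zero>, \<zero>, \<one>)"
  shows "i \<otimes>\<^bsub>Q\<^esub> i = (a, \<zero>, \<zero>, \<zero>)" "j \<otimes>\<^bsub>Q\<^esub> j = (b, \<zero>, \<zero>, \<zero>)"
    "i \<otimes>\<^bsub>Q\<^esub> j = k" "j \<otimes>\<^bsub>Q\<^esub> i = \<ominus>\<^bsub>Q\<^esub> k"
proof -
  interpret Q: ring Q
    unfolding Q_def by (rule gen_quaternion_ring_is_ring) fact+
  have "\<ominus>\<^bsub>Q\<^esub> k = (\<zero>, \<zero>, \<zero>, \<ominus> \<one>)"
    by (rule Q.minus_equality)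
      (auto simp: Q_def k_def gen_quaternion_ring_def l_neg)
  with assms show "i \<otimes>\<^bsub>Q\<^esub> i = (a, \<zero>, \<zero>, \<zero>)" "j \<otimes>\<^bsub>Q\<^esub> j = (b, \<zero>, \<zero>, \<zero>)"
    "i \<otimes>\<^bsub>Q\<^esub> j = k" "j \<otimes>\<^bsub>Q\<^esub> i = \<ominus>\<^bsub>Q\<^esub> k"
    by (auto simp: gen_quaternion_ring_def minus_eq)
qed

lemma gen_quaternion_ring_bilinear:
  assumes "a \<in> carrier R" "b \<in> carrier R" "r \<in> carrier R"
  defines "Q \<equiv> gen_quaternion_ring R a b"
    and "scale \<equiv> (\<lambda>r (x0, x1, x2, x3). (r \<otimes> x0, r \<otimes> x1, r \<otimes> x2, r \<otimes> x3))"
  assumes "x \<in> carrier Q" "y \<in> carrier Q"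
  shows "scale r x \<otimes>\<^bsub>Q\<^esub> y = scale r (x \<otimes>\<^bsub>Q\<^esub> y)" "x \<otimes>\<^bsub>Q\<^esub> scale r y = scale r (x \<otimes>\<^bsub>Q\<^esub> y)"
  using assms
  by (auto simp: gen_quaternion_ring_def minus_eq r_distr r_minus m_ac)

lemma equiv_ring_iso_rel_on:
  "equiv (gen_quaternion_rings R) (ring_iso_rel_on (gen_quaternion_rings R))"
proof (rule equivI)
  show "refl_on (gen_quaternion_rings R) (ring_iso_rel_on (gen_quaternion_rings R))"
    by (auto simp: refl_on_def ring_iso_rel_on_def is_ring_iso_def ring_iso_def ring_hom_def
        intro!: exI[of _ id])
  show "sym (ring_iso_rel_on (gen_quaternion_rings R))"
    by (auto simp: sym_def ring_iso_rel_on_def gen_quaternion_rings_def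
        intro!: ring_iso_sym gen_quaternion_ring_is_ring)
  show "trans (ring_iso_rel_on (gen_quaternion_rings R))"
    by (auto simp: trans_def ring_iso_rel_on_def intro: ring_iso_trans)
qed (auto simp: ring_iso_rel_on_def)

end

end

(*
  Write a = u p^s and b = v p^t with units u, v. Exchanging i and j, scaling i and j by units, and
  replacing j by (x + y i) j changes (a, b) into (b, a), (a c^2, b d^2) and (a, b (x^2 - a y^2)). If
  g = r^2 + 1 is a non-square mod p, these moves and the rotation i' = r i + j, j' = -i + r j for
  a = b bring every pair into the form (g^e p^s, g^f p^t) with s <= t, where moreover e = 0 if s = t
  and f = 0 if s = 0 or t = k. There are 2 k^2 + 2 such pairs.

  Conversely, an isomorphism maps i and j to orthogonal vectors for the quadratic form
  <a', b', -a' b'> of the pure quaternions, since an element that is not a scalar mod p and has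
  scalar square is pure. Reducing the resulting congruences modulo suitable powers of p recovers s,
  then t, then e, and comparing Gram determinants recovers f.
*)

theory Submission
  imports Defs "HOL-Number_Theory.Euler_Criterion" "HOL-Library.Product_Plus"
begin

section \<open>Quaternions over the integers and their reduction\<close>

type_synonym quat = "int \<times> int \<times> int \<times> int"

text \<open>Over the integers the structure maps below satisfy exact polynomial identities;
  reduction modulo \<open>m\<close> is applied only at the end.\<close>

fun qmul :: "int \<Rightarrow> int \<Rightarrow> quat \<Rightarrow> quat \<Rightarrow> quat" where
  "qmul a b (x0, x1, x2, x3) (y0, y1, y2, y3) =
    (x0 * y0 + a * (x1 * y1) + b * (x2 * y2) - a * b * (x3 * y3),
     x0 * y1 + x1 * y0 - b * (x2 * y3) + b * (x3 * y2),
     x0 * y2 + x2 * y0 + a * (x1 * y3) - a * (x3 * y1),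
     x0 * y3 + x3 * y0 + x1 * y2 - x2 * y1)"

fun qmod :: "int \<Rightarrow> quat \<Rightarrow> quat" where
  "qmod m (x0, x1, x2, x3) = (x0 mod m, x1 mod m, x2 mod m, x3 mod m)"

lemma qmod_eq_iff:
  "qmod m (x0, x1, x2, x3) = qmod m (y0, y1, y2, y3) \<longleftrightarrow>
    [x0 = y0] (mod m) \<and> [x1 = y1] (mod m) \<and> [x2 = y2] (mod m) \<and> [x3 = y3] (mod m)"
  by (simp add: cong_def)

definition quat_ring :: "int \<Rightarrow> int \<Rightarrow> int \<Rightarrow> quat ring" where
  "quat_ring m a b = gen_quaternion_ring (residue_ring m) (a mod m) (b mod m)"

lemma qmod_qmod [simp]: "qmod m (qmod m X) = qmod m X"
  by (cases X) simp

lemma qmod_add: "qmod m (qmod m X + qmod m Y) = qmod m (X + Y)"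
  by (cases X; cases Y) (simp add: mod_simps)

lemma qmod_qmul: "qmod m (qmul a b (qmod m X) (qmod m Y)) = qmod m (qmul a b X Y)"
  by (cases X; cases Y; simp only: qmod.simps qmul.simps prod.inject cong_def[symmetric];
      intro conjI cong_add cong_diff cong_mult cong_refl; simp)

text \<open>The images of \<open>i\<close> and \<open>j\<close> are \<open>c i\<close> and \<open>(x + y i) j\<close>.\<close>

definition norm_map :: "int \<Rightarrow> int \<Rightarrow> int \<Rightarrow> int \<Rightarrow> quat \<Rightarrow> quat" where
  "norm_map a c x y = (\<lambda>(x0, x1, x2, x3). (x0, c * x1, x * x2 + c * a * y * x3, y * x2 + c * x * x3))"

text \<open>Since j i = - i j, the element (x + y i) j has square b (x^2 - a y^2) and anticommutes
  with c i; the image of k is the product c i (x + y i) j.\<close>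

lemma norm_map_qmul:
  "norm_map a c x y (qmul (a * c\<^sup>2) (b * (x\<^sup>2 - a * y\<^sup>2)) X Y) =
    qmul a b (norm_map a c x y X) (norm_map a c x y Y)"
proof -
  obtain x0 x1 x2 x3 where X: "X = (x0, x1, x2, x3)" by (cases X)
  obtain y0 y1 y2 y3 where Y: "Y = (y0, y1, y2, y3)" by (cases Y)
  show ?thesis
    unfolding X Y norm_map_def qmul.simps prod.case prod.inject
    by (intro conjI; Groebner_Basis.algebra)
qed

text \<open>The images of \<open>i\<close> and \<open>j\<close> are \<open>x i + y j\<close> and \<open>- y i + x j\<close>.\<close>

definition rotate_map :: "int \<Rightarrow> int \<Rightarrow> quat \<Rightarrow> quat" where
  "rotate_map x y =
    (\<lambda>(x0, x1, x2, x3). (x0, x * x1 - y * x2, y * x1 + x * x2, (x\<^sup>2 + y\<^sup>2) * x3))"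

text \<open>When i and j anticommute and share the square a, the elements x i + y j and - y i + x j
  anticommute, both have square a (x^2 + y^2), and their product is (x^2 + y^2) k.\<close>

lemma rotate_map_qmul:
  "rotate_map x y (qmul (a * (x\<^sup>2 + y\<^sup>2)) (a * (x\<^sup>2 + y\<^sup>2)) X Y) =
    qmul a a (rotate_map x y X) (rotate_map x y Y)"
proof -
  obtain x0 x1 x2 x3 where X: "X = (x0, x1, x2, x3)" by (cases X)
  obtain y0 y1 y2 y3 where Y: "Y = (y0, y1, y2, y3)" by (cases Y)
  show ?thesis
    unfolding X Y rotate_map_def qmul.simps prod.case prod.inject
    by (intro conjI; Groebner_Basis.algebra)
qed

section \<open>Reduced rings and explicit isomorphisms between them\<close>

context
  fixes m :: int
  assumes m_gt_1: "m > 1"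
begin

interpretation residues m "residue_ring m"
  by unfold_locales (use m_gt_1 in auto)

lemma carrier_quat_ring: "carrier (quat_ring m a b) = {0..m-1} \<times> {0..m-1} \<times> {0..m-1} \<times> {0..m-1}"
  by (simp add: quat_ring_def gen_quaternion_ring_def residue_ring_def)

lemma qmod_in_carrier [simp]: "qmod m X \<in> carrier (quat_ring m a b)"
  using m_gt_1 by (cases X) (auto simp: carrier_quat_ring)

lemma qmod_carrier: "X \<in> carrier (quat_ring m a b) \<Longrightarrow> qmod m X = X"
  by (auto simp: carrier_quat_ring)

lemma quat_ring_add: "X \<oplus>\<^bsub>quat_ring m a b\<^esub> Y = qmod m (X + Y)"
  by (cases X; cases Y) (simp add: quat_ring_def gen_quaternion_ring_def residue_ring_def)

lemma quat_ring_mult: "X \<otimes>\<^bsub>quat_ring m a b\<^esub> Y = qmod m (qmul a b X Y)"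
  by (cases X; cases Y)
    (simp add: quat_ring_def gen_quaternion_ring_def a_minus_def res_add_eq res_mult_eq res_neg_eq
      mod_simps)

lemma quat_ring_one: "\<one>\<^bsub>quat_ring m a b\<^esub> = (1, 0, 0, 0)"
  by (simp add: quat_ring_def gen_quaternion_ring_def residue_ring_def)

lemma quat_ring_zero: "\<zero>\<^bsub>quat_ring m a b\<^esub> = (0, 0, 0, 0)"
  by (simp add: quat_ring_def gen_quaternion_ring_def residue_ring_def)

lemma ring_quat_ring: "ring (quat_ring m a b)"
  unfolding quat_ring_def
  by (rule gen_quaternion_ring_is_ring) (use m_gt_1 in \<open>auto simp: residue_ring_def\<close>)

text \<open>Read in one direction, \<open>cong\<close> says that \<open>L\<close> descends to
  residues, in the other that the induced map is injective; surjectivity follows because both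
  carriers are finite of the same size.\<close>

lemma quat_ring_isoI:
  assumes cong: "\<And>X Y. qmod m (L X) = qmod m (L Y) \<longleftrightarrow> qmod m X = qmod m Y"
    and add: "\<And>X Y. L (X + Y) = L X + L Y"
    and mult: "\<And>X Y. L (qmul a b X Y) = qmul c d (L X) (L Y)"
    and one: "L (1, 0, 0, 0) = (1, 0, 0, 0)"
  shows "quat_ring m a b \<simeq> quat_ring m c d"
proof -
  let ?A = "quat_ring m a b" and ?B = "quat_ring m c d"
  let ?h = "\<lambda>X. qmod m (L X)"
  have L_qmod: "qmod m (L (qmod m X)) = qmod m (L X)" for X
    by (simp add: cong)
  have "?h \<in> ring_hom ?A ?B"
  proof (rule ring_hom_memI)
    fix X Y
    show "?h (X \<otimes>\<^bsub>?A\<^esub> Y) = ?h X \<otimes>\<^bsub>?B\<^esub> ?h Y"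
      by (simp add: quat_ring_mult L_qmod mult qmod_qmul)
    show "?h (X \<oplus>\<^bsub>?A\<^esub> Y) = ?h X \<oplus>\<^bsub>?B\<^esub> ?h Y"
      by (simp add: quat_ring_add L_qmod add qmod_add)
  next
    show "?h \<one>\<^bsub>?A\<^esub> = \<one>\<^bsub>?B\<^esub>"
      using m_gt_1 by (simp add: quat_ring_one one)
  qed simp
  moreover have inj: "inj_on ?h (carrier ?A)"
    by (rule inj_onI) (metis cong qmod_carrier)
  moreover have "?h ` carrier ?A = carrier ?B"
  proof (rule card_subset_eq)
    show "card (?h ` carrier ?A) = card (carrier ?B)"
      using card_image[OF inj] by (simp add: carrier_quat_ring)
    show "?h ` carrier ?A \<subseteq> carrier ?B"
      by (intro image_subsetI) simp
  qed (simp add: carrier_quat_ring)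
  ultimately have "?h \<in> ring_iso ?A ?B"
    by (auto simp: ring_iso_def bij_betw_def)
  then show ?thesis
    by (auto simp: is_ring_iso_def)
qed

lemma quat_ring_swap: "quat_ring m a b \<simeq> quat_ring m b a"
proof (rule quat_ring_isoI)
  \<comment> \<open>Exchanging i and j sends k = i j to j i = - k.\<close>
  let ?L = "\<lambda>(x0, x1, x2, x3). (x0, x2, x1, - x3) :: quat"
  show "qmod m (?L X) = qmod m (?L Y) \<longleftrightarrow> qmod m X = qmod m Y" for X Y
    by (cases X; cases Y) (simp add: qmod_eq_iff cong_minus_minus_iff conj_ac del: qmod.simps)
  show "?L (X + Y) = ?L X + ?L Y" for X Y
    by (cases X; cases Y) simp
  show "?L (qmul a b X Y) = qmul b a (?L X) (?L Y)" for X Y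
    by (cases X; cases Y) (simp add: algebra_simps)
qed simp

lemma quat_ring_norm:
  assumes c: "coprime c m" and N: "coprime (x\<^sup>2 - a * y\<^sup>2) m"
  shows "quat_ring m (a * c\<^sup>2) (b * (x\<^sup>2 - a * y\<^sup>2)) \<simeq> quat_ring m a b"
proof (rule quat_ring_isoI)
  let ?L = "norm_map a c x y"
  show "?L (X + Y) = ?L X + ?L Y" for X Y
    by (cases X; cases Y) (simp add: norm_map_def algebra_simps)
  show "?L (qmul (a * c\<^sup>2) (b * (x\<^sup>2 - a * y\<^sup>2)) X Y) = qmul a b (?L X) (?L Y)" for X Y
    by (rule norm_map_qmul)
  \<comment> \<open>Injectivity on the span of j and k: elimination isolates each coordinate up to a
    unit, the determinant c (x^2 - a y^2) being coprime to \<open>m\<close>.\<close>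
  have "m dvd x2 \<and> m dvd x3" if "m dvd x * x2 + c * a * y * x3" "m dvd y * x2 + c * x * x3" for x2 x3
  proof -
    have "m dvd x * (x * x2 + c * a * y * x3) - a * y * (y * x2 + c * x * x3)"
      by (rule dvd_diff[OF dvd_mult dvd_mult]) fact+
    also have "\<dots> = (x\<^sup>2 - a * y\<^sup>2) * x2"
      by (simp add: algebra_simps power2_eq_square)
    finally have "m dvd x2"
      using N by (simp add: coprime_dvd_mult_right_iff coprime_commute)
    have "m dvd x * (y * x2 + c * x * x3) - y * (x * x2 + c * a * y * x3)"
      by (rule dvd_diff[OF dvd_mult dvd_mult]) fact+
    also have "\<dots> = (x\<^sup>2 - a * y\<^sup>2) * (c * x3)"
      by (simp add: algebra_simps power2_eq_square)
    finally have "m dvd x3"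
      using N c by (simp add: coprime_dvd_mult_right_iff coprime_commute)
    with \<open>m dvd x2\<close> show ?thesis by simp
  qed
  note lin = this
  have *: "m dvd x2 - y2 \<and> m dvd x3 - y3"
    if "m dvd (x * x2 + c * a * y * x3) - (x * y2 + c * a * y * y3)"
       "m dvd (y * x2 + c * x * x3) - (y * y2 + c * x * y3)" for x2 x3 y2 y3
    using that by (intro lin) (simp_all only: algebra_simps)
  have **: "m dvd x1 - y1" if "m dvd c * x1 - c * y1" for x1 y1
    using that c by (simp only: coprime_dvd_mult_right_iff coprime_commute[of m] right_diff_distrib[symmetric])
  show "qmod m (?L X) = qmod m (?L Y) \<longleftrightarrow> qmod m X = qmod m Y" for X Y
  proof
    assume "qmod m (?L X) = qmod m (?L Y)"
    then show "qmod m X = qmod m Y"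
      by (cases X; cases Y; simp only: norm_map_def prod.case qmod_eq_iff cong_iff_dvd_diff;
          use * ** in blast)
  next
    assume "qmod m X = qmod m Y"
    then show "qmod m (?L X) = qmod m (?L Y)"
      by (cases X; cases Y; simp only: norm_map_def prod.case qmod_eq_iff;
          intro conjI cong_add cong_diff cong_mult cong_refl; simp)
  qed
qed (simp add: norm_map_def)

lemma quat_ring_rotate:
  assumes N: "coprime (x\<^sup>2 + y\<^sup>2) m"
  shows "quat_ring m (a * (x\<^sup>2 + y\<^sup>2)) (a * (x\<^sup>2 + y\<^sup>2)) \<simeq> quat_ring m a a"
proof (rule quat_ring_isoI)
  let ?N = "x\<^sup>2 + y\<^sup>2"
  let ?L = "rotate_map x y"
  show "?L (X + Y) = ?L X + ?L Y" for X Y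
    by (cases X; cases Y) (simp add: rotate_map_def algebra_simps)
  show "?L (qmul (a * ?N) (a * ?N) X Y) = qmul a a (?L X) (?L Y)" for X Y
    by (rule rotate_map_qmul)
  \<comment> \<open>The same elimination: \<open>?N\<close> is the determinant on the span of i and
    j, and also the factor on k.\<close>
  have "m dvd x1 \<and> m dvd x2" if "m dvd x * x1 - y * x2" "m dvd y * x1 + x * x2" for x1 x2
  proof -
    have "m dvd x * (x * x1 - y * x2) + y * (y * x1 + x * x2)"
      by (rule dvd_add[OF dvd_mult dvd_mult]) fact+
    also have "\<dots> = ?N * x1"
      by (simp add: algebra_simps power2_eq_square)
    finally have "m dvd x1"
      using N by (simp add: coprime_dvd_mult_right_iff coprime_commute)
    have "m dvd x * (y * x1 + x * x2) - y * (x * x1 - y * x2)"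
      by (rule dvd_diff[OF dvd_mult dvd_mult]) fact+
    also have "\<dots> = ?N * x2"
      by (simp add: algebra_simps power2_eq_square)
    finally have "m dvd x2"
      using N by (simp add: coprime_dvd_mult_right_iff coprime_commute)
    with \<open>m dvd x1\<close> show ?thesis by simp
  qed
  note lin = this
  have *: "m dvd x1 - y1 \<and> m dvd x2 - y2"
    if "m dvd (x * x1 - y * x2) - (x * y1 - y * y2)"
       "m dvd (y * x1 + x * x2) - (y * y1 + x * y2)" for x1 x2 y1 y2
    using that by (intro lin) (simp_all only: algebra_simps)
  have **: "m dvd x3 - y3" if "m dvd ?N * x3 - ?N * y3" for x3 y3
    using that N by (simp only: coprime_dvd_mult_right_iff coprime_commute[of m] right_diff_distrib[symmetric])
  show "qmod m (?L X) = qmod m (?L Y) \<longleftrightarrow> qmod m X = qmod m Y" for X Y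
  proof
    assume "qmod m (?L X) = qmod m (?L Y)"
    then show "qmod m X = qmod m Y"
      by (cases X; cases Y; simp only: rotate_map_def prod.case qmod_eq_iff cong_iff_dvd_diff;
          use * ** in blast)
  next
    assume "qmod m X = qmod m Y"
    then show "qmod m (?L X) = qmod m (?L Y)"
      by (cases X; cases Y; simp only: rotate_map_def prod.case qmod_eq_iff;
          intro conjI cong_add cong_diff cong_mult cong_refl; simp)
  qed
qed (simp add: rotate_map_def)

end

section \<open>Isomorphisms and the quadratic form of pure quaternions\<close>

text \<open>An element x0 + v with v pure has scalar square only if 2 x0 v = 0. Injectivity of
  \<open>h\<close> prevents v from vanishing modulo p, so some coordinate of v is a unit and x0 = 0.
  \<open>E\<close> covers i and j at once.\<close>

lemma quat_ring_iso_pureE: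
  fixes p k :: nat and a b c d e :: int
  defines "m \<equiv> int p ^ k"
  assumes p: "prime p" "odd p" "k > 0"
    and h: "h \<in> ring_iso (quat_ring m a b) (quat_ring m c d)"
    and E: "E = (0, 1, 0, 0) \<and> e = a \<or> E = (0, 0, 1, 0) \<and> e = b"
  obtains x1 x2 x3 where "h E = (0, x1, x2, x3)"
    and "[e = c * x1\<^sup>2 + d * x2\<^sup>2 - c * d * x3\<^sup>2] (mod m)"
proof -
  let ?A = "quat_ring m a b" and ?B = "quat_ring m c d"
  have p': "prime (int p)" using p by simp
  have m: "m > 1"
    unfolding m_def using p prime_gt_1_nat[of p] by (simp add: one_less_power)
  have hom: "h \<in> ring_hom ?A ?B" and bij: "bij_betw h (carrier ?A) (carrier ?B)"
    using h by (auto simp: ring_iso_def)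
  note add = ring_hom_add[OF hom, unfolded quat_ring_add[OF m]]
  note mult = ring_hom_mult[OF hom, unfolded quat_ring_mult[OF m]]
  have [simp]: "qmod m X \<in> carrier (quat_ring m u v)" for X u v
    by (rule qmod_in_carrier[OF m])
  have E_carrier: "E \<in> carrier ?A"
    using E m by (auto simp: carrier_quat_ring[OF m])
  \<comment> \<open>Scalars are sums of copies of 1, so \<open>h\<close> fixes them.\<close>
  have h_nat: "h (qmod m (int n, 0, 0, 0)) = qmod m (int n, 0, 0, 0)" for n
  proof (induction n)
    case 0
    show ?case
      using ring_hom_zero[OF hom ring_quat_ring[OF m] ring_quat_ring[OF m]]
      by (simp add: quat_ring_zero[OF m])
  next
    case (Suc n)
    have "h (qmod m (int (Suc n), 0, 0, 0)) = h (qmod m (qmod m (int n, 0, 0, 0) + qmod m (1, 0, 0, 0)))"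
      by (simp only: qmod_add) (simp add: add.commute)
    also have "\<dots> = qmod m (h (qmod m (int n, 0, 0, 0)) + h (qmod m (1, 0, 0, 0)))"
      by (rule add) (simp_all del: qmod.simps)
    also have "h (qmod m (1, 0, 0, 0)) = qmod m (1, 0, 0, 0)"
      using ring_hom_one[OF hom] m by (simp add: quat_ring_one[OF m])
    finally show ?case
      unfolding Suc by (simp only: qmod_add) (simp add: add.commute)
  qed
  have h_scalar: "h (qmod m (z, 0, 0, 0)) = qmod m (z, 0, 0, 0)" for z
    using h_nat[of "nat (z mod m)"] m by simp
  obtain x0 x1 x2 x3 where hE: "h E = (x0, x1, x2, x3)"
    by (cases "h E")
  have x0: "0 \<le> x0" "x0 < m"
    using bij_betwE[OF bij] E_carrier hE by (force simp: carrier_quat_ring[OF m])+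
  have "h (qmod m (e, 0, 0, 0)) = h (qmod m (qmul a b E E))"
    using E by auto
  also have "\<dots> = qmod m (qmul c d (h E) (h E))"
    by (rule mult) fact+
  finally have *: "qmod m (e, 0, 0, 0) = qmod m (qmul c d (h E) (h E))"
    unfolding h_scalar .
  then have sq: "[e = x0\<^sup>2 + c * x1\<^sup>2 + d * x2\<^sup>2 - c * d * x3\<^sup>2] (mod m)"
    and "[0 = 2 * x0 * x1] (mod m)" "[0 = 2 * x0 * x2] (mod m)" "[0 = 2 * x0 * x3] (mod m)"
    by (simp_all add: hE cong_def power2_eq_square algebra_simps)
  then have dvd: "m dvd 2 * x0 * x1" "m dvd 2 * x0 * x2" "m dvd 2 * x0 * x3"
    by (simp_all only: cong_0_iff cong_sym_eq[of 0])
  have "\<not> (int p dvd x1 \<and> int p dvd x2 \<and> int p dvd x3)"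
  proof
    assume *: "int p dvd x1 \<and> int p dvd x2 \<and> int p dvd x3"
    \<comment> \<open>Multiplication by p^(k-1) kills coordinates divisible by p, so z h(E) is a
      scalar and hence fixed by \<open>h\<close>; injectivity makes z E scalar, which is false since
      z is nonzero modulo \<open>m\<close>.\<close>
    define z where "z = int p ^ (k - 1)"
    have m_eq: "m = z * int p"
      using p(3) by (cases k) (simp_all add: m_def z_def)
    have "m dvd z * x1" "m dvd z * x2" "m dvd z * x3"
      using * by (simp_all add: m_eq mult_dvd_mono)
    then have "qmod m (z * x0, 0, 0, 0) = qmod m (qmul c d (z, 0, 0, 0) (h E))"
      by (simp add: hE)
    also have "\<dots> = qmod m (qmul c d (h (qmod m (z, 0, 0, 0))) (h E))"
      unfolding h_scalar hE by (simp add: mod_simps)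
    also have "\<dots> = h (qmod m (qmul a b (qmod m (z, 0, 0, 0)) E))"
      by (rule mult[symmetric]) (simp_all add: E_carrier del: qmod.simps)
    also have "qmod m (qmul a b (qmod m (z, 0, 0, 0)) E) = qmod m (qmul a b (z, 0, 0, 0) E)"
      using E by (auto simp: mod_simps)
    also have "qmod m (z * x0, 0, 0, 0) = h (qmod m (z * x0, 0, 0, 0))"
      by (rule h_scalar[symmetric])
    finally have "qmod m (z * x0, 0, 0, 0) = qmod m (qmul a b (z, 0, 0, 0) E)"
      using bij by (auto simp: bij_betw_def inj_on_eq_iff simp del: qmod.simps)
    then have "m dvd z"
      using E by auto
    then have "int p dvd 1"
      using p by (simp add: m_eq z_def)
    then show False using p' by (metis not_prime_unit)
  qed
  moreover have "m dvd x0" if "\<not> int p dvd x" "m dvd 2 * x0 * x" for x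
  proof -
    have "coprime m x"
      using that(1) p' by (simp add: m_def prime_imp_coprime)
    moreover have "coprime m 2"
      using p by (simp add: m_def)
    ultimately show ?thesis
      using that(2) by (simp add: coprime_dvd_mult_left_iff coprime_dvd_mult_right_iff)
  qed
  ultimately have "m dvd x0"
    using dvd by blast
  with x0 have "x0 = 0"
    by (metis zdvd_not_zless le_less)
  with sq hE that show thesis
    by simp
qed

text \<open>Isomorphic rings have isometric norm forms: \<open>i\<close> and \<open>j\<close> are mapped to pure quaternions that
  anticommute, i.e. are orthogonal for the form \<open>\<langle>c, d, -cd\<rangle>\<close>.\<close>

lemma quat_ring_isoE:
  fixes p k :: nat and a b c d :: int
  defines "m \<equiv> int p ^ k"
  assumes p: "prime p" "odd p" "k > 0"
    and iso: "quat_ring m a b \<simeq> quat_ring m c d"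
  obtains x1 x2 x3 y1 y2 y3 where
    "[a = c * x1\<^sup>2 + d * x2\<^sup>2 - c * d * x3\<^sup>2] (mod m)"
    "[b = c * y1\<^sup>2 + d * y2\<^sup>2 - c * d * y3\<^sup>2] (mod m)"
    "[0 = c * x1 * y1 + d * x2 * y2 - c * d * x3 * y3] (mod m)"
proof -
  let ?A = "quat_ring m a b" and ?B = "quat_ring m c d"
  let ?i = "(0, 1, 0, 0)" and ?j = "(0, 0, 1, 0)"
  have m: "m > 1"
    unfolding m_def using p prime_gt_1_nat[of p] by (simp add: one_less_power)
  obtain h where h: "h \<in> ring_iso ?A ?B"
    using iso by (auto simp: is_ring_iso_def)
  then have hom: "h \<in> ring_hom ?A ?B"
    by (simp add: ring_iso_def)
  obtain x1 x2 x3 where x: "h ?i = (0, x1, x2, x3)"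
    and x_sq: "[a = c * x1\<^sup>2 + d * x2\<^sup>2 - c * d * x3\<^sup>2] (mod m)"
    using quat_ring_iso_pureE[OF p h[unfolded m_def], of ?i a] unfolding m_def by blast
  obtain y1 y2 y3 where y: "h ?j = (0, y1, y2, y3)"
    and y_sq: "[b = c * y1\<^sup>2 + d * y2\<^sup>2 - c * d * y3\<^sup>2] (mod m)"
    using quat_ring_iso_pureE[OF p h[unfolded m_def], of ?j b] unfolding m_def by blast
  have carr: "?i \<in> carrier ?A" "?j \<in> carrier ?A"
    using m by (auto simp: carrier_quat_ring[OF m])
  \<comment> \<open>For pure x and y the scalar part of x y + y x is twice the bilinear form, and 2
    is a unit modulo \<open>m\<close>.\<close>
  have "\<zero>\<^bsub>?A\<^esub> = (?i \<otimes>\<^bsub>?A\<^esub> ?j) \<oplus>\<^bsub>?A\<^esub> (?j \<otimes>\<^bsub>?A\<^esub> ?i)"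
    by (simp add: quat_ring_mult[OF m] quat_ring_add[OF m] quat_ring_zero[OF m] mod_simps)
  then have "\<zero>\<^bsub>?B\<^esub> = (h ?i \<otimes>\<^bsub>?B\<^esub> h ?j) \<oplus>\<^bsub>?B\<^esub> (h ?j \<otimes>\<^bsub>?B\<^esub> h ?i)"
    using ring_hom_zero[OF hom ring_quat_ring[OF m] ring_quat_ring[OF m]] carr
      ring.ring_simprules(5)[OF ring_quat_ring[OF m]]
    by (simp add: ring_hom_add[OF hom] ring_hom_mult[OF hom])
  then have "m dvd 2 * (c * x1 * y1 + d * x2 * y2 - c * d * x3 * y3)"
    by (simp add: quat_ring_mult[OF m] quat_ring_add[OF m] quat_ring_zero[OF m] x y mod_simps
        algebra_simps mod_eq_0_iff_dvd)
  moreover have "coprime m 2"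
    using p by (simp add: m_def)
  ultimately have "m dvd c * x1 * y1 + d * x2 * y2 - c * d * x3 * y3"
    by (simp only: coprime_dvd_mult_right_iff)
  then have "[0 = c * x1 * y1 + d * x2 * y2 - c * d * x3 * y3] (mod m)"
    by (metis cong_0_iff cong_sym)
  with x_sq y_sq that show thesis by blast
qed

section \<open>Squares modulo prime powers\<close>

text \<open>Hensel lifting: as p is odd and c is a unit, the derivative 2 x of x^2 - c is invertible
  at a root, which can thus be refined digit by digit.\<close>

lemma QuadRes_prime_power:
  fixes p c :: int
  assumes p: "prime p" "odd p" and c: "\<not> p dvd c" and "QuadRes p c"
  shows "QuadRes (p ^ k) c"
proof (cases k)
  case (Suc n)
  have "\<exists>x. [x\<^sup>2 = c] (mod p ^ Suc n)"
  proof (induction n)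
    case 0
    show ?case using assms by (simp add: QuadRes_def)
  next
    case (Suc n)
    let ?q = "p ^ Suc n"
    from Suc obtain x where "?q dvd x\<^sup>2 - c"
      unfolding cong_iff_dvd_diff by blast
    then obtain w where x: "x\<^sup>2 - c = ?q * w"
      by (rule dvdE)
    have "p dvd x\<^sup>2 - c"
      unfolding x by simp
    have "\<not> p dvd x"
    proof
      assume "p dvd x"
      then have "p dvd x\<^sup>2"
        by (simp add: power2_eq_square)
      then have "p dvd x\<^sup>2 - (x\<^sup>2 - c)"
        using \<open>p dvd x\<^sup>2 - c\<close> by (rule dvd_diff)
      with c show False by simp
    qed
    then have "coprime (2 * x) p"
      using p by (simp add: prime_imp_coprime coprime_commute)
    then obtain u where u: "[2 * x * u = 1] (mod p)"
      using cong_solve_coprime_int by blast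
    \<comment> \<open>With x^2 - c = \<open>?q\<close> w, passing to x + \<open>?q\<close> z changes
      the quotient w to w + 2 x z modulo p; this z makes it vanish.\<close>
    define z where "z = u * (- w)"
    have "[2 * x * z = - w] (mod p)"
      using cong_scalar_right[OF u, of "- w"] by (simp only: z_def mult.assoc mult_1)
    then have "p dvd 2 * x * z + w"
      by (simp add: cong_iff_dvd_diff)
    then obtain v where v: "2 * x * z + w = p * v"
      by (rule dvdE)
    have "(x + ?q * z)\<^sup>2 - c = (x\<^sup>2 - c) + ?q * (2 * x * z) + ?q * ?q * z\<^sup>2"
      by (simp add: power2_eq_square algebra_simps)
    also have "\<dots> = ?q * (2 * x * z + w) + ?q * ?q * z\<^sup>2"
      unfolding x by (simp only: algebra_simps)
    also have "\<dots> = p ^ Suc (Suc n) * (v + p ^ n * z\<^sup>2)"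
      unfolding v by (simp add: algebra_simps power2_eq_square)
    finally have "[(x + ?q * z)\<^sup>2 = c] (mod p ^ Suc (Suc n))"
      by (simp only: cong_iff_dvd_diff dvd_triv_left)
    then show ?case by blast
  qed
  then show ?thesis
    by (simp add: Suc QuadRes_def)
qed (simp add: QuadRes_def)

text \<open>1 and -1 have the same square and are distinct for p > 2, so squaring on the finite set
  of residues is not injective, hence not surjective.\<close>

lemma ex_not_QuadRes:
  fixes p :: nat
  assumes "p > 2"
  shows "\<exists>a. \<not> QuadRes (int p) a"
proof (rule ccontr)
  let ?S = "{0..<int p}" and ?f = "\<lambda>x. x\<^sup>2 mod int p"
  have "(int p - 1)\<^sup>2 = 1 + int p * (int p - 2)"
    by (simp add: power2_eq_square algebra_simps)
  then have "?f 1 = ?f (int p - 1)"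
    by simp
  then have "\<not> inj_on ?f ?S"
    using inj_onD[of ?f ?S 1 "int p - 1"] assms by auto
  then have "\<not> ?S \<subseteq> ?f ` ?S"
    using finite_surj_inj[of ?S ?f] by auto
  then obtain a where a: "a \<in> ?S" "a \<notin> ?f ` ?S"
    by blast
  assume all: "\<nexists>a. \<not> QuadRes (int p) a"
  then obtain y where "[y\<^sup>2 = a] (mod int p)"
    by (auto simp: QuadRes_def)
  then have "?f (y mod int p) = a"
    using a by (simp add: cong_def mod_simps power_mod)
  moreover have "y mod int p \<in> ?S"
    using assms by simp
  ultimately show False
    using a by blast
qed

text \<open>Otherwise the squares would be closed under adding 1; starting from 0 they would exhaust
  all residues.\<close>

lemma ex_not_QuadRes_square_plus_1:
  fixes p :: nat
  assumes "p > 2"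
  shows "\<exists>r. \<not> QuadRes (int p) (r\<^sup>2 + 1)"
proof (rule ccontr)
  assume *: "\<nexists>r. \<not> QuadRes (int p) (r\<^sup>2 + 1)"
  have nat: "QuadRes (int p) (int n)" for n
  proof (induction n)
    case 0
    show ?case by (auto simp: QuadRes_def intro!: exI[of _ 0])
  next
    case (Suc n)
    then obtain y where y: "[y\<^sup>2 = int n] (mod int p)"
      by (auto simp: QuadRes_def)
    from * obtain z where "[z\<^sup>2 = y\<^sup>2 + 1] (mod int p)"
      by (auto simp: QuadRes_def)
    also have "[y\<^sup>2 + 1 = int n + 1] (mod int p)"
      using y by (intro cong_add cong_refl)
    finally show ?case
      by (auto simp: QuadRes_def add.commute)
  qed
  obtain a where a: "\<not> QuadRes (int p) a"
    using ex_not_QuadRes[OF assms] by blast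
  have "[int (nat (a mod int p)) = a] (mod int p)"
    using assms by simp
  with nat[of "nat (a mod int p)"] a show False
    unfolding QuadRes_def by (blast intro: cong_trans)
qed

text \<open>Euler's criterion makes the Legendre symbol multiplicative modulo p; two values -1 give
  1, which differs from -1 modulo p.\<close>

lemma QuadRes_mult:
  fixes p :: nat
  assumes p: "prime p" "odd p" and "\<not> QuadRes (int p) a" "\<not> QuadRes (int p) b"
  shows "QuadRes (int p) (a * b)"
proof -
  have p2: "p > 2"
    using p prime_gt_1_nat[of p] by (cases "p = 2") auto
  have zero: "QuadRes (int p) c" if "[c = 0] (mod int p)" for c
    using that unfolding QuadRes_def by (intro exI[of _ 0]) (simp add: cong_sym_eq[of 0])
  have L: "Legendre c (int p) = - 1" if "\<not> QuadRes (int p) c" for c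
    using that zero by (auto simp: Legendre_def)
  have "[Legendre (a * b) (int p) = (a * b) ^ ((p - 1) div 2)] (mod int p)"
    by (rule euler_criterion) fact+
  also have "(a * b) ^ ((p - 1) div 2) = a ^ ((p - 1) div 2) * b ^ ((p - 1) div 2)"
    by (rule power_mult_distrib)
  also have "[\<dots> = Legendre a (int p) * Legendre b (int p)] (mod int p)"
    by (intro cong_mult; rule cong_sym, rule euler_criterion; fact)
  finally have "[Legendre (a * b) (int p) = 1] (mod int p)"
    using assms by (simp add: L)
  moreover have "\<not> [- 1 = 1] (mod int p)"
    using p2 zdvd_imp_le[of "int p" 2] by (auto simp: cong_iff_dvd_diff)
  ultimately show ?thesis
    using L[of "a * b"] by (cases "QuadRes (int p) (a * b)") simp_all
qed

section \<open>Classification\<close>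

text \<open>The code \<open>(s, t, e, f)\<close> stands for the pair \<open>(g^e p^s, g^f p^t)\<close> modulo \<open>p^k\<close>, for a fixed
  non-square \<open>g\<close> modulo \<open>p\<close>; so the exponent \<open>k\<close> encodes a zero parameter.\<close>

definition quat_codes :: "nat \<Rightarrow> (nat \<times> nat \<times> nat \<times> nat) set" where
  "quat_codes k = {(s, t, e, f). s \<le> t \<and> t \<le> k \<and> e \<le> 1 \<and> f \<le> 1 \<and>
     (s = t \<longrightarrow> e = 0) \<and> (s = 0 \<or> t = k \<longrightarrow> f = 0)}"

text \<open>Sorted by t, there is 1 code for t = 0, 4 t for 0 < t < k, and 2 k + 1 for t = k; these
  sum to 2 + 2 k + 2 k (k - 1).\<close>

lemma card_quat_codes:
  assumes "k > 0"
  shows "card (quat_codes k) = 2 * k\<^sup>2 + 2"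
proof -
  define C :: "nat \<Rightarrow> (nat \<times> nat \<times> nat) set" where "C t = {(s, e, f). s \<le> t \<and> e \<le> 1 \<and> f \<le> 1 \<and>
     (s = t \<longrightarrow> e = 0) \<and> (s = 0 \<or> t = k \<longrightarrow> f = 0)}" for t
  have fin: "finite (C t)" for t
    by (rule finite_subset[of _ "{..t} \<times> {..1} \<times> {..1}"]) (auto simp: C_def)
  have "bij_betw (\<lambda>(t, s, e, f). (s, t, e, f)) (Sigma {..k} C) (quat_codes k)"
    by (rule bij_betw_byWitness[where f' = "\<lambda>(s, t, e, f). (t, s, e, f)"])
      (auto simp: C_def quat_codes_def)
  then have "card (quat_codes k) = card (Sigma {..k} C)"
    by (simp add: bij_betw_same_card)
  also have "\<dots> = (\<Sum>t\<le>k. card (C t))"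
    using fin by simp
  also have "{..k} = insert 0 (insert k {1..<k})"
    using assms by auto
  also have "(\<Sum>t\<in>\<dots>. card (C t)) = card (C 0) + card (C k) + (\<Sum>t=1..<k. card (C t))"
    using assms by simp
  also have "C 0 = {(0, 0, 0)}"
    by (auto simp: C_def)
  also have "C k = insert (k, 0, 0) ({..<k} \<times> {..1} \<times> {0})"
    by (auto simp: C_def)
  also have "card \<dots> = 2 * k + 1"
    by (simp add: card_insert_if)
  also have "(\<Sum>t=1..<k. card (C t)) = (\<Sum>t=1..<k. 4 * t)"
  proof (rule sum.cong)
    fix t assume t: "t \<in> {1..<k}"
    \<comment> \<open>The cases s = 0, s = t and 0 < s < t contribute 2, 2 and 4 (t - 1)
      codes.\<close>
    then have "C t = ({0} \<times> {..1} \<times> {0}) \<union> ({t} \<times> {0} \<times> {..1}) \<union> ({1..<t} \<times> {..1} \<times> {..1})"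
      by (auto simp: C_def)
    also have "card \<dots> = 4 * t"
      using t by (subst card_Un_disjoint; (subst card_Un_disjoint)?) auto
    finally show "card (C t) = 4 * t" .
  qed simp
  also have "(\<Sum>t=1..<k. 4 * t) = 2 * k * (k - 1)"
  proof -
    have "(\<Sum>t=1..<Suc n. 4 * t) = 2 * Suc n * n" for n :: nat
      by (induction n) simp_all
    from this[of "k - 1"] show ?thesis
      using assms by simp
  qed
  finally show ?thesis
    using assms by (cases k) (auto simp: power2_eq_square algebra_simps)
qed

text \<open>The shape r^2 + 1 makes g a sum of two squares, as the rotation requires, and gives g =
  g^2 - g r^2, a norm when the first parameter is g.\<close>

locale square_plus_1_nonresidue =
  fixes p k :: nat and g r m :: int
  assumes prime_p: "prime p" and odd_p: "odd p" and k_pos: "k > 0"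
    and not_QuadRes_g: "\<not> QuadRes (int p) g" and g_eq: "g = r\<^sup>2 + 1"
    and m_eq: "m = int p ^ k"
begin

lemma prime_int_p: "prime (int p)"
  using prime_p by simp

lemma m_gt_1: "m > 1"
  unfolding m_eq using k_pos prime_p prime_gt_1_nat[of p] by (simp add: one_less_power)

lemma not_dvd_1: "\<not> int p dvd 1"
  using prime_int_p not_prime_unit by blast

lemma g_not_dvd: "\<not> int p dvd g"
proof
  assume "int p dvd g"
  then have "[0\<^sup>2 = g] (mod int p)"
    by (simp add: cong_0_iff cong_sym_eq[of 0])
  with not_QuadRes_g show False
    unfolding QuadRes_def by blast
qed

lemma not_dvd_g_power: "\<not> int p dvd g ^ e"
  using g_not_dvd prime_dvd_power[OF prime_int_p] by blast

lemma coprime_m_iff: "coprime u m \<longleftrightarrow> \<not> int p dvd u"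
  using prime_imp_coprime[OF prime_int_p, of u] k_pos prime_int_p
  by (auto simp: m_eq coprime_commute dest: coprime_common_divisor)

lemma power_dvd_unit_mult_iff:
  assumes "\<not> int p dvd u"
  shows "int p ^ n dvd u * int p ^ s \<longleftrightarrow> n \<le> s"
proof
  have "coprime (int p ^ n) u"
    using prime_imp_coprime[OF prime_int_p assms] by simp
  moreover assume "int p ^ n dvd u * int p ^ s"
  ultimately have "int p ^ n dvd int p ^ s"
    by (simp only: coprime_dvd_mult_right_iff)
  then show "n \<le> s"
    using prime_gt_1_nat[OF prime_p] by (simp add: dvd_power_iff_le flip: of_nat_power)
qed (simp add: le_imp_power_dvd)

text \<open>The square classes of 1 and g differ: 1 = g x^2 would give (g x)^2 = g.\<close>

lemma g_power_cong_unique: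
  assumes "e \<le> 1" "e' \<le> 1" "[g ^ e = g ^ e' * x\<^sup>2] (mod int p)"
  shows "e = e'"
proof (rule ccontr)
  assume "e \<noteq> e'"
  with assms consider "e = 1" "e' = 0" | "e = 0" "e' = 1"
    by linarith
  then show False
  proof cases
    case 1
    with assms(3) not_QuadRes_g show False
      unfolding QuadRes_def using cong_sym by auto
  next
    case 2
    then have "[1 = g * x\<^sup>2] (mod int p)"
      using assms by simp
    then have "[g * 1 = g * (g * x\<^sup>2)] (mod int p)"
      by (rule cong_scalar_left)
    then have "[(g * x)\<^sup>2 = g] (mod int p)"
      by (simp add: power2_eq_square mult_ac cong_sym_eq)
    with not_QuadRes_g show False
      unfolding QuadRes_def by blast
  qed
qed

section \<open>Invariants of an isomorphism class\<close>

abbreviation Q :: "int \<Rightarrow> int \<Rightarrow> quat ring" where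
  "Q a b \<equiv> quat_ring m a b"

lemma iso_sym: "Q a b \<simeq> Q c d \<Longrightarrow> Q c d \<simeq> Q a b"
  by (rule ring_iso_sym[OF ring_quat_ring[OF m_gt_1]])

lemma Q_cong: "[a = c] (mod m) \<Longrightarrow> [b = d] (mod m) \<Longrightarrow> Q a b = Q c d"
  by (simp add: quat_ring_def cong_def)

text \<open>All coefficients of the form <c, d, -cd> are divisible by p^s', which bounds s from
  below. If s = s', the form modulo p^t' is just c z^2, and orthogonality of the images of i and j
  forces p^t' to divide b.\<close>

lemma iso_exponents_le:
  assumes iso: "Q (u * int p ^ s) (v * int p ^ t) \<simeq> Q (u' * int p ^ s') (v' * int p ^ t')"
    and u: "\<not> int p dvd u" and v: "\<not> int p dvd v"
    and le: "s \<le> t" "t \<le> k" "s' \<le> t'" "t' \<le> k"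
  shows "s' \<le> s" and "s = s' \<Longrightarrow> t' \<le> t"
proof -
  let ?P = "\<lambda>n. int p ^ n"
  let ?a = "u * ?P s" and ?b = "v * ?P t" and ?c = "u' * ?P s'" and ?d = "v' * ?P t'"
  obtain x1 x2 x3 y1 y2 y3 where
    x: "[?a = ?c * x1\<^sup>2 + ?d * x2\<^sup>2 - ?c * ?d * x3\<^sup>2] (mod m)" and
    y: "[?b = ?c * y1\<^sup>2 + ?d * y2\<^sup>2 - ?c * ?d * y3\<^sup>2] (mod m)" and
    xy: "[0 = ?c * x1 * y1 + ?d * x2 * y2 - ?c * ?d * x3 * y3] (mod m)"
    using quat_ring_isoE[OF prime_p odd_p k_pos iso[unfolded m_eq]] unfolding m_eq by blast
  have dvd_m: "?P n dvd m" if "n \<le> k" for n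
    using that by (simp add: m_eq le_imp_power_dvd)
  have c_d: "?P s' dvd ?c" "?P s' dvd ?d"
    using le by (simp_all add: le_imp_power_dvd)
  have "?P s' dvd ?c * x1\<^sup>2 + ?d * x2\<^sup>2 - ?c * ?d * x3\<^sup>2"
    by (rule dvd_diff[OF dvd_add[OF dvd_mult2 dvd_mult2] dvd_mult2[OF dvd_mult2]]) (rule c_d)+
  moreover have "[?a = ?c * x1\<^sup>2 + ?d * x2\<^sup>2 - ?c * ?d * x3\<^sup>2] (mod ?P s')"
    using x dvd_m[of s'] le by (meson cong_dvd_modulus order_trans)
  ultimately have "?P s' dvd ?a"
    by (simp only: cong_dvd_iff)
  then show "s' \<le> s"
    using u by (simp add: power_dvd_unit_mult_iff)
  show "t' \<le> t" if "s = s'"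
  proof (rule ccontr)
    assume "\<not> t' \<le> t"
    then have "t < t'" by simp
    note mod_t' = cong_dvd_modulus[OF _ dvd_m[OF \<open>t' \<le> k\<close>]]
    have d: "[z + ?d * z' - ?c * ?d * z'' = z] (mod ?P t')" for z z' z''
      by (simp add: cong_iff_dvd_diff)
    have x': "[?a = ?c * x1\<^sup>2] (mod ?P t')"
      using cong_trans[OF mod_t'[OF x] d] .
    have y': "[?b = ?c * y1\<^sup>2] (mod ?P t')"
      using cong_trans[OF mod_t'[OF y] d] .
    have "[0 = ?c * x1 * y1] (mod ?P t')"
      using cong_trans[OF mod_t'[OF xy], of "?c * x1 * y1"] d[of "?c * x1 * y1" "x2 * y2" "x3 * y3"]
      by (simp only: mult.assoc)
    then have xy': "?P t' dvd x1 * (?c * y1)"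
      by (simp add: cong_0_iff cong_sym_eq[of 0] mult_ac)
    \<comment> \<open>\<open>?c\<close> x1^2 must have valuation exactly s, like \<open>?a\<close>,
      and \<open>?c\<close> already supplies p^s.\<close>
    have "\<not> int p dvd x1"
    proof
      assume "int p dvd x1"
      then have "?P (Suc s) dvd ?c * x1\<^sup>2"
        using that by (simp add: power2_eq_square mult_dvd_mono mult.commute[of "int p"] dvd_mult)
      moreover have "[?a = ?c * x1\<^sup>2] (mod ?P (Suc s))"
        using cong_dvd_modulus[OF x' le_imp_power_dvd[of "Suc s" t']] \<open>t < t'\<close> le by simp
      ultimately have "?P (Suc s) dvd ?a"
        by (simp only: cong_dvd_iff)
      then show False
        using power_dvd_unit_mult_iff[OF u, of "Suc s" s] by simp
    qed
    then have "coprime (?P t') x1"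
      using prime_imp_coprime[OF prime_int_p] by simp
    with xy' have "?P t' dvd ?c * y1"
      by (simp only: coprime_dvd_mult_right_iff)
    then have "?P t' dvd ?c * y1\<^sup>2"
      by (simp only: power2_eq_square mult.assoc[symmetric] dvd_mult2)
    with y' have "?P t' dvd ?b"
      by (simp only: cong_dvd_iff)
    then have "t' \<le> t"
      using power_dvd_unit_mult_iff[OF v, of t' t] by simp
    with \<open>t < t'\<close> show False by simp
  qed
qed

text \<open>The square class \<open>f\<close> is read off the Gram determinant of the images of \<open>i\<close> and \<open>j\<close>, which is
  known modulo \<open>p^(s + t + 1)\<close> since \<open>s > 0\<close>.\<close>

lemma iso_classes_eq:
  assumes iso: "Q (g ^ e * int p ^ s) (g ^ f * int p ^ t) \<simeq> Q (g ^ e' * int p ^ s) (g ^ f' * int p ^ t)"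
    and ef: "e \<le> 1" "f \<le> 1" "e' \<le> 1" "f' \<le> 1"
    and le: "s \<le> t" "t \<le> k"
  shows "s < t \<Longrightarrow> e = e'" and "e = e' \<Longrightarrow> 0 < s \<Longrightarrow> t < k \<Longrightarrow> f = f'"
proof -
  let ?P = "\<lambda>n. int p ^ n"
  let ?a = "g ^ e * ?P s" and ?b = "g ^ f * ?P t" and ?c = "g ^ e' * ?P s" and ?d = "g ^ f' * ?P t"
  obtain x1 x2 x3 y1 y2 y3 where
    x: "[?a = ?c * x1\<^sup>2 + ?d * x2\<^sup>2 - ?c * ?d * x3\<^sup>2] (mod m)" and
    y: "[?b = ?c * y1\<^sup>2 + ?d * y2\<^sup>2 - ?c * ?d * y3\<^sup>2] (mod m)" and
    xy: "[0 = ?c * x1 * y1 + ?d * x2 * y2 - ?c * ?d * x3 * y3] (mod m)"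
    using quat_ring_isoE[OF prime_p odd_p k_pos iso[unfolded m_eq]] unfolding m_eq by blast
  have dvd_m: "?P n dvd m" if "n \<le> k" for n
    using that by (simp add: m_eq le_imp_power_dvd)
  have P_cancel: "int p dvd z" if "?P (Suc n) dvd ?P n * z" for n z
    using that prime_p by (simp add: prime_gt_0_nat)
  show "e = e'" if "s < t"
  proof (rule g_power_cong_unique)
    \<comment> \<open>As s < t, d vanishes modulo p^(s+1) and only c x1^2 survives.\<close>
    have "?P (Suc s) dvd ?d"
      using that by (simp add: le_imp_power_dvd dvd_mult del: power_Suc)
    then have "[?c * x1\<^sup>2 + ?d * x2\<^sup>2 - ?c * ?d * x3\<^sup>2 = ?c * x1\<^sup>2] (mod ?P (Suc s))"
      by (simp add: cong_iff_dvd_diff dvd_diff dvd_mult2 dvd_mult del: power_Suc)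
    with x have "[?a = ?c * x1\<^sup>2] (mod ?P (Suc s))"
      using cong_dvd_modulus[OF x dvd_m[of "Suc s"]] that le by (auto intro: cong_trans)
    then have "?P (Suc s) dvd ?P s * (g ^ e - g ^ e' * x1\<^sup>2)"
      by (simp only: cong_iff_dvd_diff algebra_simps)
    then show "[g ^ e = g ^ e' * x1\<^sup>2] (mod int p)"
      unfolding cong_iff_dvd_diff by (rule P_cancel)
  qed fact+
  show "f = f'" if "e = e'" "0 < s" "t < k"
  proof (rule g_power_cong_unique)
    \<comment> \<open>Gram matrix of the images of i and j, truncated to the binary form <c, d>;
      \<open>D\<close> below is the determinant of their first two coordinates.\<close>
    define \<alpha> \<beta> \<gamma> where "\<alpha> = ?c * x1\<^sup>2 + ?d * x2\<^sup>2" and "\<beta> = ?c * y1\<^sup>2 + ?d * y2\<^sup>2"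
      and "\<gamma> = ?c * x1 * y1 + ?d * x2 * y2"
    define D where "D = x1 * y2 - x2 * y1"
    \<comment> \<open>Since s > 0, the valuation of c d exceeds t, so the third coordinate is
      invisible modulo p^(t+1).\<close>
    have "?P (Suc t) dvd ?P s * ?P t"
      using that by (simp add: le_imp_power_dvd flip: power_add power_Suc)
    then have cd: "?P (Suc t) dvd ?c * ?d"
      by (metis dvd_mult mult.assoc mult.left_commute)
    have m: "?P (Suc t) dvd m"
      using that by (intro dvd_m) simp
    have drop: "?P (Suc t) dvd z - w" if "[z = w - ?c * ?d * w'] (mod m)" for z w w'
    proof -
      have "?P (Suc t) dvd z - (w - ?c * ?d * w')"
        using that m unfolding cong_iff_dvd_diff by (rule dvd_trans[rotated])
      then have "?P (Suc t) dvd z - (w - ?c * ?d * w') - ?c * ?d * w'"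
        using dvd_mult2[OF cd] by (rule dvd_diff)
      then show ?thesis by simp
    qed
    have \<alpha>: "?P (Suc t) dvd ?a - \<alpha>" and \<beta>: "?P (Suc t) dvd ?b - \<beta>"
      using drop[OF x] drop[OF y] by (simp_all only: \<alpha>_def \<beta>_def)
    have "?P (Suc t) dvd 0 - \<gamma>"
      using drop[of 0 \<gamma> "x3 * y3"] xy by (simp only: \<gamma>_def mult.assoc)
    then have \<gamma>: "?P (Suc t) dvd \<gamma>" by simp
    have "?P t dvd \<beta>"
    proof -
      have "?P t dvd ?b - (?b - \<beta>)"
        using dvd_trans[OF le_imp_power_dvd \<beta>, of t] by (rule dvd_diff[OF dvd_triv_right]) simp
      then show ?thesis
        by (simp only: diff_diff_eq2 add_diff_cancel_left')
    qed
    then have "?P s dvd \<beta>"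
      using le dvd_trans le_imp_power_dvd by blast
    \<comment> \<open>Precision p^(t+1) in one factor and divisibility by p^s of the other give
      p^(s+t+1), one digit beyond the valuation of a b.\<close>
    have "?P (Suc (s + t)) dvd (?a - \<alpha>) * \<beta>"
      using mult_dvd_mono[OF \<alpha> \<open>?P s dvd \<beta>\<close>] by (simp add: power_add mult_ac)
    moreover have "?P (Suc (s + t)) dvd ?a * (?b - \<beta>)"
      using mult_dvd_mono[of "?P s" ?a, OF _ \<beta>] by (simp add: power_add mult_ac)
    moreover have "?P (Suc (s + t)) dvd \<gamma> * \<gamma>"
    proof -
      have "?P (Suc (s + t)) dvd ?P (Suc t) * ?P (Suc t)"
        using le by (simp add: le_imp_power_dvd flip: power_add power_Suc)
      then show ?thesis
        using mult_dvd_mono[OF \<gamma> \<gamma>] by (rule dvd_trans)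
    qed
    ultimately have "?P (Suc (s + t)) dvd (?a - \<alpha>) * \<beta> + ?a * (?b - \<beta>) + \<gamma> * \<gamma>"
      by (intro dvd_add)
    also have "(?a - \<alpha>) * \<beta> + ?a * (?b - \<beta>) + \<gamma> * \<gamma> = ?a * ?b - (\<alpha> * \<beta> - \<gamma> * \<gamma>)"
      by (simp add: algebra_simps)
    also have "\<alpha> * \<beta> - \<gamma> * \<gamma> = ?c * ?d * D\<^sup>2"
      unfolding \<alpha>_def \<beta>_def \<gamma>_def D_def by Groebner_Basis.algebra
    also have "?a * ?b - ?c * ?d * D\<^sup>2 = ?P (s + t) * (g ^ e * (g ^ f - g ^ f' * D\<^sup>2))"
      using that by (simp add: power_add algebra_simps)
    finally have "int p dvd g ^ e * (g ^ f - g ^ f' * D\<^sup>2)"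
      by (rule P_cancel)
    then have "int p dvd g ^ f - g ^ f' * D\<^sup>2"
      using not_dvd_g_power[of e] prime_int_p by (simp add: prime_dvd_mult_iff)
    then show "[g ^ f = g ^ f' * D\<^sup>2] (mod int p)"
      by (simp add: cong_iff_dvd_diff)
  qed fact+
qed

fun rep :: "nat \<times> nat \<times> nat \<times> nat \<Rightarrow> quat ring" where
  "rep (s, t, e, f) = Q (g ^ e * int p ^ s) (g ^ f * int p ^ t)"

text \<open>The exponent bounds, applied to the isomorphism and its inverse, give equal exponents.
  Where \<open>iso_classes_eq\<close> says nothing about a square class, the codes set it to
  0.\<close>

lemma rep_iso_imp_eq:
  assumes "C \<in> quat_codes k" "C' \<in> quat_codes k" "rep C \<simeq> rep C'"
  shows "C = C'"
proof -
  obtain s t e f s' t' e' f' where C: "C = (s, t, e, f)" "C' = (s', t', e', f')"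
    by (cases C; cases C')
  note iso = assms(3)[unfolded C rep.simps]
  note codes = assms(1,2)[unfolded C quat_codes_def, simplified]
  have le: "s \<le> t" "t \<le> k" "s' \<le> t'" "t' \<le> k" and ef: "e \<le> 1" "f \<le> 1" "e' \<le> 1" "f' \<le> 1"
    using codes by auto
  note exps = iso_exponents_le[OF iso not_dvd_g_power not_dvd_g_power le]
    iso_exponents_le[OF iso_sym[OF iso] not_dvd_g_power not_dvd_g_power le(3,4,1,2)]
  have s: "s' = s"
    using exps(1,3) by simp
  have t: "t' = t"
    using exps(2,4) s by simp
  note classes = iso_classes_eq[OF iso[unfolded s t] ef le(1,2)]
  have e: "e = e'"
  proof (cases "s = t")
    case False
    with le classes(1) show ?thesis by simp
  qed (use codes s t in auto)
  have "f = f'"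
  proof (cases "s = 0 \<or> t = k")
    case False
    with le classes(2) e show ?thesis by simp
  qed (use codes s t in auto)
  with s t e show ?thesis by (simp add: C)
qed

section \<open>Reduction to normal forms\<close>

lemma QuadRes_liftE:
  assumes "QuadRes (int p) u" "\<not> int p dvd u"
  obtains c where "[c\<^sup>2 = u] (mod m)" "\<not> int p dvd c"
proof -
  obtain c where c: "[c\<^sup>2 = u] (mod m)"
    using QuadRes_prime_power[OF prime_int_p _ assms(2,1), of k] odd_p
    by (auto simp: QuadRes_def m_eq)
  have "int p dvd m"
    using k_pos by (simp add: m_eq)
  then have "\<not> int p dvd c\<^sup>2"
    using cong_dvd_iff[OF cong_dvd_modulus[OF c]] assms(2) by blast
  then have "\<not> int p dvd c"
    by (auto simp: power2_eq_square)
  with c that show thesis by blast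
qed

text \<open>The case y = 0 of \<open>quat_ring_norm\<close>, where the norm is d^2.\<close>

lemma iso_scale_squares:
  assumes "\<not> int p dvd c" "\<not> int p dvd d"
  shows "Q (a * c\<^sup>2) (b * d\<^sup>2) \<simeq> Q a b"
  using quat_ring_norm[OF m_gt_1, of c d a 0 b] assms prime_dvd_power[OF prime_int_p, of d 2]
  by (auto simp: coprime_m_iff)

text \<open>The unit part of a is a square or g times a square modulo p, and this lifts to p^k;
  scaling i then removes the square. Uniformity in b allows the other parameter to be normalised
  already.\<close>

lemma iso_normalise_first:
  obtains s e where "s \<le> k" "e \<le> 1" "s = k \<longrightarrow> e = 0" "\<forall>b. Q a b \<simeq> Q (g ^ e * int p ^ s) b"
proof (cases "int p ^ k dvd a")
  case True
  then have "[a = g ^ 0 * int p ^ k] (mod m)"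
    by (simp add: m_eq cong_iff_dvd_diff)
  from that[of k 0] Q_cong[OF this cong_refl] show thesis
    by (simp add: ring_iso_refl)
next
  case False
  then have "a \<noteq> 0" by auto
  then obtain u where a: "a = int p ^ multiplicity (int p) a * u" and u: "\<not> int p dvd u"
    using multiplicity_decompose'[OF _ not_dvd_1] by blast
  define s where "s = multiplicity (int p) a"
  have "s < k"
  proof (rule ccontr)
    assume "\<not> s < k"
    then have "int p ^ k dvd int p ^ s"
      by (simp add: le_imp_power_dvd)
    with False show False
      using a unfolding s_def by (metis dvd_mult2)
  qed
  \<comment> \<open>The factor d avoids inverting g: for a non-square u, c^2 = g u gives u g^2 = g
    c^2.\<close>
  obtain e c d where "e \<le> (1::nat)" "\<not> int p dvd c" "\<not> int p dvd d" and eq: "[u * d\<^sup>2 = g ^ e * c\<^sup>2] (mod m)"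
  proof (cases "QuadRes (int p) u")
    case True
    then obtain c where c: "[c\<^sup>2 = u] (mod m)" "\<not> int p dvd c"
      using QuadRes_liftE u by blast
    with c that[of 0 c 1] show thesis
      using not_dvd_1 by (auto simp: cong_sym)
  next
    case False
    then have "QuadRes (int p) (g * u)"
      using QuadRes_mult[OF prime_p odd_p not_QuadRes_g] by simp
    moreover have gu: "\<not> int p dvd g * u"
      using g_not_dvd u prime_int_p by (simp add: prime_dvd_mult_iff)
    ultimately obtain c where c: "[c\<^sup>2 = g * u] (mod m)" "\<not> int p dvd c"
      using QuadRes_liftE by blast
    have "[u * g\<^sup>2 = g ^ 1 * c\<^sup>2] (mod m)"
      using cong_scalar_left[OF cong_sym[OF c(1)], of g] by (simp add: power2_eq_square mult_ac)
    with c(2) show thesis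
      using that[of 1 c g] g_not_dvd by simp
  qed
  have "Q a b \<simeq> Q (g ^ e * int p ^ s) b" for b
  proof -
    have "Q a b \<simeq> Q (a * d\<^sup>2) (b * 1\<^sup>2)"
      by (intro iso_sym[OF iso_scale_squares] not_dvd_1) fact
    also have "Q (a * d\<^sup>2) (b * 1\<^sup>2) = Q (g ^ e * int p ^ s * c\<^sup>2) (b * 1\<^sup>2)"
    proof (rule Q_cong)
      have "[int p ^ s * (u * d\<^sup>2) = int p ^ s * (g ^ e * c\<^sup>2)] (mod m)"
        using eq by (rule cong_scalar_left)
      then show "[a * d\<^sup>2 = g ^ e * int p ^ s * c\<^sup>2] (mod m)"
        by (subst a, fold s_def) (simp only: mult_ac)
    qed simp
    finally have "Q a b \<simeq> Q (g ^ e * int p ^ s * c\<^sup>2) (b * 1\<^sup>2)" .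
    moreover have "\<dots> \<simeq> Q (g ^ e * int p ^ s) b"
      by (intro iso_scale_squares not_dvd_1) fact
    ultimately show ?thesis
      by (rule ring_iso_trans)
  qed
  with \<open>s < k\<close> \<open>e \<le> 1\<close> that[of s e] show thesis by simp
qed

text \<open>Up to a square factor, g is a norm x^2 - g^e y^2 and can be absorbed into j. Hence codes
  with s = 0 only need f = 0.\<close>

lemma iso_drop_unit_class:
  assumes "e \<le> 1"
  shows "Q (g ^ e) (g * b) \<simeq> Q (g ^ e) b"
proof (cases "e = 0")
  case True
  have "\<not> int p dvd 2"
    using odd_p prime_p primes_dvd_imp_eq two_is_prime_nat by (metis even_of_nat int_dvd_int_iff of_nat_numeral dvd_refl)
  then have "\<not> int p dvd 4 * g"
    using g_not_dvd prime_int_p prime_dvd_mult_iff[of "int p" 2 2] by (simp add: prime_dvd_mult_iff)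
  \<comment> \<open>For first parameter 1 the norms are differences of squares; this one is g up to
    2^2, which scaling j by 2 absorbs.\<close>
  moreover have eq: "(g + 1)\<^sup>2 - 1 * (g - 1)\<^sup>2 = 4 * g"
    by (simp add: power2_eq_square algebra_simps)
  ultimately have "Q (1 * 1\<^sup>2) (b * (4 * g)) \<simeq> Q 1 b"
    using quat_ring_norm[OF m_gt_1, of 1 "g + 1" 1 "g - 1" b] not_dvd_1 by (simp only: eq coprime_m_iff simp_thms)
  moreover have "Q (1 * 1\<^sup>2) (g * b * 2\<^sup>2) \<simeq> Q 1 (g * b)"
    using not_dvd_1 \<open>\<not> int p dvd 2\<close> by (rule iso_scale_squares)
  ultimately show ?thesis
    using True ring_iso_trans[OF iso_sym] by (simp add: mult_ac)
next
  case False
  with assms have "e = 1" by simp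
  have eq: "g\<^sup>2 - g * r\<^sup>2 = g"
    by (simp add: g_eq power2_eq_square algebra_simps)
  from quat_ring_norm[OF m_gt_1, of 1 g g r b] show ?thesis
    using g_not_dvd not_dvd_1 by (simp add: eq coprime_m_iff \<open>e = 1\<close> mult_ac)
qed

lemma iso_rep:
  obtains C where "C \<in> quat_codes k" "Q a b \<simeq> rep C"
proof -
  obtain s e where se: "s \<le> k" "e \<le> 1" "s = k \<longrightarrow> e = 0"
    and iso1: "\<forall>b. Q a b \<simeq> Q (g ^ e * int p ^ s) b"
    by (rule iso_normalise_first)
  obtain t f where tf: "t \<le> k" "f \<le> 1" "t = k \<longrightarrow> f = 0"
    and iso2: "\<forall>a. Q b a \<simeq> Q (g ^ f * int p ^ t) a"
    by (rule iso_normalise_first)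
  \<comment> \<open>\<open>ok\<close> leaves out the conditions of \<open>quat_codes\<close> for s =
    t and for s = 0; the two adjustments below arrange these.\<close>
  define ok where "ok C \<longleftrightarrow> (case C of (s, t, e, f) \<Rightarrow>
    s \<le> t \<and> t \<le> k \<and> e \<le> 1 \<and> f \<le> 1 \<and> (s = k \<longrightarrow> e = 0) \<and> (t = k \<longrightarrow> f = 0))" for C :: "nat \<times> nat \<times> nat \<times> nat"
  note swap = quat_ring_swap[OF m_gt_1]
  have rep1: "Q a b \<simeq> rep (t, s, f, e)"
    using ring_iso_trans[OF spec[OF iso1] ring_iso_trans[OF swap spec[OF iso2]]] by simp
  have rep2: "Q a b \<simeq> rep (s, t, e, f)"
    using ring_iso_trans[OF rep1[unfolded rep.simps] swap] by simp
  obtain s t e f where 1: "ok (s, t, e, f)" "Q a b \<simeq> rep (s, t, e, f)"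
  proof (cases "s \<le> t")
    case True
    with se tf show thesis by (intro that[OF _ rep2]) (simp add: ok_def)
  next
    case False
    with se tf show thesis by (intro that[OF _ rep1]) (simp add: ok_def)
  qed
  \<comment> \<open>If s = t and e = 1, then f = 0 is settled by a swap, and f = 1 by the rotation
    with r^2 + 1 = g, which clears both classes.\<close>
  obtain e' f' where 2: "ok (s, t, e', f')" "Q a b \<simeq> rep (s, t, e', f')" "s = t \<longrightarrow> e' = 0"
  proof (cases "s = t \<and> e = 1")
    case False
    have "e \<le> 1" using 1 by (simp add: ok_def)
    with False have "s = t \<longrightarrow> e = 0" by auto
    with 1 that[of e f] show thesis by blast
  next
    case True
    have "f \<le> 1" using 1 by (simp add: ok_def)
    then consider "f = 0" | "f = 1" by linarith
    then show thesis
    proof cases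
      case 1
      then have "Q a b \<simeq> rep (s, t, 0, 1)"
        using True ring_iso_trans[OF \<open>Q a b \<simeq> rep (s, t, e, f)\<close>[unfolded rep.simps] swap] by simp
      with that[of 0 1] True \<open>ok (s, t, e, f)\<close> show thesis by (auto simp: ok_def)
    next
      case 2
      have "Q (int p ^ s * g) (int p ^ s * g) \<simeq> Q (int p ^ s) (int p ^ s)"
        using quat_ring_rotate[OF m_gt_1, of r 1 "int p ^ s"] g_not_dvd
        by (simp add: coprime_m_iff flip: g_eq)
      then have "Q a b \<simeq> rep (s, t, 0, 0)"
        using True 2 \<open>Q a b \<simeq> rep (s, t, e, f)\<close> by (simp add: mult.commute[of g] ring_iso_trans)
      with that[of 0 0] True \<open>ok (s, t, e, f)\<close> show thesis by (auto simp: ok_def)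
    qed
  qed
  show thesis
  proof (cases "s = 0 \<and> f' = 1")
    case False
    with 2 that[of "(s, t, e', f')"] show thesis
      by (auto simp: ok_def quat_codes_def)
  next
    case True
    have "e' \<le> 1" using 2 by (simp add: ok_def)
    from iso_drop_unit_class[OF this, of "int p ^ t"] have "rep (s, t, e', f') \<simeq> rep (s, t, e', 0)"
      using True by simp
    then have "Q a b \<simeq> rep (s, t, e', 0)"
      by (rule ring_iso_trans[OF 2(2)])
    with 2 that[of "(s, t, e', 0)"] show thesis
      by (auto simp: ok_def quat_codes_def)
  qed
qed

section \<open>Counting the isomorphism classes\<close>

lemma gen_quaternion_rings_eq: "gen_quaternion_rings (residue_ring m) = range (\<lambda>(a, b). Q a b)"
proof (intro equalityI subsetI)
  fix A assume "A \<in> gen_quaternion_rings (residue_ring m)"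
  then obtain a b where A: "A = gen_quaternion_ring (residue_ring m) a b"
    and "a \<in> {0..m-1}" "b \<in> {0..m-1}"
    by (auto simp: gen_quaternion_rings_def residue_ring_def)
  then have "A = Q a b"
    by (simp add: quat_ring_def)
  then show "A \<in> range (\<lambda>(a, b). Q a b)"
    by auto
next
  fix A assume "A \<in> range (\<lambda>(a, b). Q a b)"
  then obtain a b where "A = gen_quaternion_ring (residue_ring m) (a mod m) (b mod m)"
    by (auto simp: quat_ring_def)
  moreover have "x mod m \<in> carrier (residue_ring m)" for x
    using m_gt_1 by (simp add: residue_ring_def)
  ultimately show "A \<in> gen_quaternion_rings (residue_ring m)"
    unfolding gen_quaternion_rings_def by blast
qed

lemma card_classes:
  "card (gen_quaternion_rings (residue_ring m) //
    ring_iso_rel_on (gen_quaternion_rings (residue_ring m))) = 2 * k\<^sup>2 + 2"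
proof -
  let ?S = "gen_quaternion_rings (residue_ring m)"
  let ?R = "ring_iso_rel_on ?S"
  interpret residues m "residue_ring m"
    by unfold_locales (use m_gt_1 in auto)
  have eq: "equiv ?S ?R"
    by (rule equiv_ring_iso_rel_on)
  have rep_S: "rep C \<in> ?S" for C
    by (cases C) (auto simp: gen_quaternion_rings_eq)
  have "bij_betw (\<lambda>C. ?R `` {rep C}) (quat_codes k) (?S // ?R)"
  proof (rule bij_betw_imageI)
    show "inj_on (\<lambda>C. ?R `` {rep C}) (quat_codes k)"
    proof (rule inj_onI)
      fix C C' assume C: "C \<in> quat_codes k" "C' \<in> quat_codes k" "?R `` {rep C} = ?R `` {rep C'}"
      then have "(rep C, rep C') \<in> ?R"
        using eq_equiv_class[OF _ eq rep_S] by blast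
      with C show "C = C'"
        by (auto simp: ring_iso_rel_on_def intro: rep_iso_imp_eq)
    qed
    have "A \<in> (\<lambda>C. ?R `` {rep C}) ` quat_codes k" if "A \<in> ?S // ?R" for A
    proof -
      from that obtain a b where A: "A = ?R `` {Q a b}"
        by (auto simp: quotient_def gen_quaternion_rings_eq)
      obtain C where C: "C \<in> quat_codes k" "Q a b \<simeq> rep C"
        using iso_rep .
      then have "(Q a b, rep C) \<in> ?R"
        using rep_S by (auto simp: ring_iso_rel_on_def gen_quaternion_rings_eq)
      then show ?thesis
        using C A equiv_class_eq[OF eq] by blast
    qed
    then show "(\<lambda>C. ?R `` {rep C}) ` quat_codes k = ?S // ?R"
      using rep_S by (auto intro: quotientI)
  qed
  then show ?thesis
    using card_quat_codes[OF k_pos] by (simp add: bij_betw_same_card)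
qed

end

theorem theorem1:
  fixes p k :: nat
  assumes "prime p" and "odd p" and "k > 0"
  shows "card (gen_quaternion_rings (residue_ring (int p ^ k)) //
           ring_iso_rel_on (gen_quaternion_rings (residue_ring (int p ^ k)))) = 2 * k^2 + 2"
proof -
  have "p > 2"
    using assms prime_gt_1_nat[of p] by (cases "p = 2") auto
  then obtain r where "\<not> QuadRes (int p) (r\<^sup>2 + 1)"
    using ex_not_QuadRes_square_plus_1 by blast
  then interpret square_plus_1_nonresidue p k "r\<^sup>2 + 1" r "int p ^ k"
    using assms by unfold_locales simp_all
  show ?thesis by (rule card_classes)
qed

end
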